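(* Let $T\in[1,\infty)$ and let $X:[0,T]\times\mathbb{T}\times\Omega\to\mathbb{R}^m$ be a continuous random field (periodic in the second argument) on a probability space $(\Omega,\mathcal{F},\mathbb{P})$. Let $\overline p=(p_1,p_2),\overline q=(q_1,q_2)\in[1,\infty)^2$ with $q_1\le q_2\le p_1\le p_2$ and let $\overline\alpha=(\alpha_1,\alpha_2)\in(0,1)^2$. Suppose there is a constant $C>0$ such that $$\mathbb{E}\big[|\square_{(h_1,h_2)}X(x_1,x_2)|^{p_2}\big]\le C\,h_1^{(1+\alpha_1q_1)\frac{p_2}{q_1}}h_2^{(1+\alpha_2q_2)\frac{p_2}{q_2}},$$ $$\mathbb{E}\big[|\delta_{h_1}X(x_1,x_2)|^{p_2}\big]\le C\,h_1^{(1+\alpha_1q_1)\frac{p_2}{q_1}}\quad\text{and}\quad\mathbb{E}\big[|\delta_{h_2}X(x_1,x_2)|^{p_2}\big]\le C\,h_2^{(1+\alpha_2q_2)\frac{p_2}{q_2}}$$ for all $h_1,h_2\in[0,T]$, $x_1\in[0,T-h_1]$ and $x_2\in\mathbb{T}$. Then $\|X\|^{(2)}_{[0,T]\times\mathbb{T},\overline\alpha,\overline p,\overline q}<\infty$ almost surely.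
   Context: $\mathbb{T}$ is the one-dimensional torus, identified with $[-\pi,\pi]$; functions on $[0,T]\times\mathbb{T}$ are viewed as $2\pi$-periodic in the second variable. $|\cdot|$ is the Euclidean norm on $\mathbb{R}^m$. A continuous random field $X$ is a family of $\mathbb{R}^m$-valued random variables $X(x_1,x_2)$, $(x_1,x_2)\in[0,T]\times\mathbb{T}$, such that $(x_1,x_2)\mapsto X(x_1,x_2)(\omega)$ is continuous for almost all $\omega\in\Omega$. Increments: $\delta_{h_1}f(x)=f(x_1+h_1,x_2)-f(x_1,x_2)$, $\delta_{h_2}f(x)=f(x_1,x_2+h_2)-f(x_1,x_2)$, $\square_{(h_1,h_2)}f(x)=f(x_1+h_1,x_2+h_2)-f(x_1,x_2+h_2)-f(x_1+h_1,x_2)+f(x_1,x_2)$. Local Besov norm with dominating mixed smoothness on $D=[0,T]\times\mathbb{T}$: for $h_1\ge0$ put $D-h_1:=[0,\max\{T-h_1,0\}]\times\mathbb{T}$; for $E=[0,S]\times\mathbb{T}$ put $\|f\|_{E,\overline p}:=\big(\int_0^S(\int_{\mathbb{T}}|f(x_1,x_2)|^{p_2}dx_2)^{p_1/p_2}dx_1\big)^{1/p_1}$; and $$\|f\|^{(2)}_{D,\overline\alpha,\overline p,\overline q}:=\|f\|_{D,\overline p}+\Big(\int_0^1h_1^{-\alpha_1q_1}\Big(\int_0^1h_2^{-\alpha_2q_2}\|\square_{(h_1,h_2)}f\|_{D-h_1,\overline p}^{q_2}\frac{dh_2}{h_2}\Big)^{q_1/q_2}\frac{dh_1}{h_1}\Big)^{1/q_1}$$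 $$\qquad+\Big(\int_0^1h_2^{-\alpha_2q_2}\|\delta_{h_2}f\|_{D,\overline p}^{q_2}\frac{dh_2}{h_2}\Big)^{1/q_2}+\Big(\int_0^1h_1^{-\alpha_1q_1}\|\delta_{h_1}f\|_{D-h_1,\overline p}^{q_1}\frac{dh_1}{h_1}\Big)^{1/q_1}.$$ $\|X\|^{(2)}_{[0,T]\times\mathbb{T},\overline\alpha,\overline p,\overline q}$ is this norm applied pathwise. *)

theory Defs
  imports "HOL-Probability.Probability"
begin

(* Powers with a positive real exponent on the extended nonnegative reals;
   only used for a > 0, hence the value at infinity. *)
definition epowr :: "ennreal \<Rightarrow> real \<Rightarrow> ennreal" where
  "epowr x a = (if x = \<infinity> then \<infinity> else ennreal (enn2real x powr a))"

(* Functions on [0,T] x torus are curried functions on reals that are 2 pi-periodic in the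
   second argument; increments use the periodic extension. *)

definition delta1 :: "real \<Rightarrow> (real \<Rightarrow> real \<Rightarrow> 'b::real_normed_vector) \<Rightarrow> real \<Rightarrow> real \<Rightarrow> 'b" where
  "delta1 h f x1 x2 = f (x1 + h) x2 - f x1 x2"

definition delta2 :: "real \<Rightarrow> (real \<Rightarrow> real \<Rightarrow> 'b::real_normed_vector) \<Rightarrow> real \<Rightarrow> real \<Rightarrow> 'b" where
  "delta2 h f x1 x2 = f x1 (x2 + h) - f x1 x2"

definition rect_incr ::
    "real \<Rightarrow> real \<Rightarrow> (real \<Rightarrow> real \<Rightarrow> 'b::real_normed_vector) \<Rightarrow> real \<Rightarrow> real \<Rightarrow> 'b" where
  "rect_incr h1 h2 f x1 x2 = f (x1 + h1) (x2 + h2) - f x1 (x2 + h2) - f (x1 + h1) x2 + f x1 x2"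

(* The mixed Lebesgue norm on [0,S] x torus, with values in [0,infinity]. *)
definition mixed_norm ::
    "real \<Rightarrow> real \<Rightarrow> real \<Rightarrow> (real \<Rightarrow> real \<Rightarrow> 'b::real_normed_vector) \<Rightarrow> ennreal" where
  "mixed_norm S p1 p2 f =
     epowr (\<integral>\<^sup>+x1\<in>{0..S}.
              epowr (\<integral>\<^sup>+x2\<in>{-pi..pi}. ennreal (norm (f x1 x2) powr p2) \<partial>lborel) (p1 / p2)
            \<partial>lborel) (1 / p1)"

(* The local Besov norm with dominating mixed smoothness on D = [0,T] x torus; the set D - h1 is
   [0, max (T - h1) 0] x torus. *)
definition besov_norm ::
    "real \<Rightarrow> real \<Rightarrow> real \<Rightarrow> real \<Rightarrow> real \<Rightarrow> real \<Rightarrow> real \<Rightarrow> (real \<Rightarrow> real \<Rightarrow> 'b::real_normed_vector) \<Rightarrow> ennreal"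
  where
  "besov_norm T \<alpha>1 \<alpha>2 p1 p2 q1 q2 f =
     mixed_norm T p1 p2 f
   + epowr (\<integral>\<^sup>+h1\<in>{0..1}. ennreal (h1 powr (- \<alpha>1 * q1) / h1) *
         epowr (\<integral>\<^sup>+h2\<in>{0..1}. ennreal (h2 powr (- \<alpha>2 * q2) / h2) *
             epowr (mixed_norm (max (T - h1) 0) p1 p2 (rect_incr h1 h2 f)) q2 \<partial>lborel) (q1 / q2)
       \<partial>lborel) (1 / q1)
   + epowr (\<integral>\<^sup>+h2\<in>{0..1}. ennreal (h2 powr (- \<alpha>2 * q2) / h2) *
         epowr (mixed_norm T p1 p2 (delta2 h2 f)) q2 \<partial>lborel) (1 / q2)
   + epowr (\<integral>\<^sup>+h1\<in>{0..1}. ennreal (h1 powr (- \<alpha>1 * q1) / h1) *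
         epowr (mixed_norm (max (T - h1) 0) p1 p2 (delta1 h1 f)) q1 \<partial>lborel) (1 / q1)"

definition continuous_random_field ::
    "'a measure \<Rightarrow> real \<Rightarrow> (real \<Rightarrow> real \<Rightarrow> 'a \<Rightarrow> 'b::real_normed_vector) \<Rightarrow> bool" where
  "continuous_random_field M T X \<longleftrightarrow>
     (\<forall>x1\<in>{0..T}. \<forall>x2. X x1 x2 \<in> borel_measurable M) \<and>
     (\<forall>x1\<in>{0..T}. \<forall>x2. \<forall>\<omega>\<in>space M. X x1 (x2 + 2 * pi) \<omega> = X x1 x2 \<omega>) \<and>
     (AE \<omega> in M. continuous_on ({0..T} \<times> UNIV) (\<lambda>(x1, x2). X x1 x2 \<omega>))"

end

theory Submission
  imports Defs
begin

text \<open>Since \<open>q1 \<le> q2 \<le> p1 \<le> p2\<close>, the powers \<open>p1 / p2\<close>, \<open>q2 / p1\<close>, \<open>q1 / p1\<close> and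
  \<open>q1 / q2\<close> by which the nested integrals are composed are concave, so the expectation
  can be pulled through the nested integrals by Tonelli and Jensen down to the increments; the resulting bound of each of the three seminorms is the integral of a constant
  over \<open>[0,1]\<close> because the moment assumptions cancel the weights exactly. The required joint
  measurability holds after setting \<open>X\<close> to \<open>0\<close> on the null set of discontinuous paths and
  extending it constantly in \<open>x1\<close> beyond \<open>[0,T]\<close>.\<close>

section \<open>Powers on the extended half-line and a Jensen-type bound\<close>

lemma epowr_ennreal: "0 \<le> x \<Longrightarrow> epowr (ennreal x) a = ennreal (x powr a)"
  by (simp add: epowr_def)

lemma epowr_less_top: "x < \<infinity> \<Longrightarrow> epowr x a < \<infinity>"
  by (simp add: epowr_def)

lemma epowr_mono: "x \<le> y \<Longrightarrow> 0 \<le> a \<Longrightarrow> epowr x a \<le> epowr y a"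
  by (cases x; cases y) (auto simp: epowr_def top_unique powr_mono2)

lemma epowr_epowr: "0 < b \<Longrightarrow> epowr (epowr x a) b = epowr x (a * b)"
  by (cases x) (auto simp: epowr_def powr_powr)

lemma measurable_epowr [measurable]:
  assumes [measurable]: "f \<in> borel_measurable N"
  shows "(\<lambda>z. epowr (f z) a) \<in> borel_measurable N"
  unfolding epowr_def by measurable

text \<open>Up to the factor 2 this is Jensen's inequality; it follows from
  \<open>t\<^sup>r \<le> c\<^sup>r (1 + t / c)\<close> without any convexity argument.\<close>

lemma (in prob_space) nn_integral_epowr_le:
  assumes [measurable]: "g \<in> borel_measurable M"
    and "0 < r" "r \<le> 1" "0 < c" and g: "(\<integral>\<^sup>+\<omega>. g \<omega> \<partial>M) \<le> ennreal c"
  shows "(\<integral>\<^sup>+\<omega>. epowr (g \<omega>) r \<partial>M) \<le> ennreal (2 * c powr r)"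
proof -
  have pt: "epowr t r \<le> ennreal (c powr r) + ennreal (c powr r / c) * t" for t
  proof (cases t)
    case (real s)
    have "(s / c) powr r \<le> 1 + s / c"
    proof (cases "s \<le> c")
      case True
      then have "(s / c) powr r \<le> 1"
        using real \<open>0 < c\<close> \<open>0 < r\<close> by (intro powr_le1) auto
      then show ?thesis using real \<open>0 < c\<close> by (simp add: add_increasing2)
    next
      case False
      then have "(s / c) powr r \<le> (s / c) powr 1"
        using \<open>0 < c\<close> \<open>r \<le> 1\<close> by (intro powr_mono) auto
      then show ?thesis using real \<open>0 < c\<close> by simp
    qed
    then have "c powr r * (s / c) powr r \<le> c powr r * (1 + s / c)"
      by (intro mult_left_mono) auto
    then have "s powr r \<le> c powr r + c powr r / c * s"
      using real \<open>0 < c\<close> by (simp add: powr_divide algebra_simps)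
    then show ?thesis
      using real \<open>0 < c\<close>
      by (simp add: epowr_ennreal ennreal_mult[symmetric] ennreal_plus[symmetric] del: ennreal_plus)
  next
    \<comment> \<open>Since \<open>c powr r / c\<close> is positive, the right side is infinite as
      well and no product of 0 with infinity arises.\<close>
    case top
    then show ?thesis using \<open>0 < c\<close> by (simp add: ennreal_mult_top)
  qed
  have "(\<integral>\<^sup>+\<omega>. epowr (g \<omega>) r \<partial>M) \<le> (\<integral>\<^sup>+\<omega>. ennreal (c powr r) + ennreal (c powr r / c) * g \<omega> \<partial>M)"
    by (intro nn_integral_mono pt)
  also have "\<dots> = ennreal (c powr r) + ennreal (c powr r / c) * (\<integral>\<^sup>+\<omega>. g \<omega> \<partial>M)"
    by (simp add: nn_integral_add nn_integral_cmult emeasure_space_1)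
  \<comment> \<open>The mean of \<open>g / c\<close> is at most 1, so both summands are bounded by
    \<open>c powr r\<close>; this is the origin of the factor 2.\<close>
  also have "\<dots> \<le> ennreal (c powr r) + ennreal (c powr r / c) * ennreal c"
    by (intro add_left_mono mult_left_mono g) auto
  also have "\<dots> = ennreal (2 * c powr r)"
    using \<open>0 < c\<close> by (simp add: ennreal_mult[symmetric] ennreal_plus[symmetric] del: ennreal_plus)
  finally show ?thesis .
qed

section \<open>Measurability and weighted moments of the mixed Lebesgue norm\<close>

text \<open>The domain \<open>{0..S z}\<close> in the mixed norm moves with the parameter, as
  \<open>D - h1\<close> does with \<open>h1\<close>, so the interval needs variable
  endpoints.\<close>

lemma measurable_indicator_Icc [measurable]:
  fixes f a b :: "_ \<Rightarrow> real"
  assumes [measurable]: "f \<in> borel_measurable N" "a \<in> borel_measurable N" "b \<in> borel_measurable N"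
  shows "(\<lambda>z. indicator {a z..b z} (f z) :: ennreal) \<in> borel_measurable N"
  unfolding indicator_def atLeastAtMost_iff by measurable

text \<open>Measurability passes through the two nested integrals one after the other. The parameter
  \<open>z\<close> stays abstract so that it can later be a tuple of step sizes and
  \<omega>.\<close>

lemma measurable_mixed_norm:
  fixes F :: "'z \<Rightarrow> real \<Rightarrow> real \<Rightarrow> 'b::{real_normed_vector, second_countable_topology}"
  assumes [measurable]: "S \<in> borel_measurable N"
    "(\<lambda>(x1, x2, z). F z x1 x2) \<in> borel_measurable (borel \<Otimes>\<^sub>M borel \<Otimes>\<^sub>M N)"
  shows "(\<lambda>z. mixed_norm (S z) p1 p2 (F z)) \<in> borel_measurable N"
proof -
  \<comment> \<open>The uncurried \<open>G\<close> is a single measurable function applied to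
    tuples, a form in which measurability of compositions can be derived automatically. The same
    device recurs below.\<close>
  define G where "G = (\<lambda>(x1, x2, z). F z x1 x2)"
  have [measurable]: "G \<in> borel_measurable (borel \<Otimes>\<^sub>M borel \<Otimes>\<^sub>M N)"
    unfolding G_def by fact
  have "F z x1 x2 = G (x1, x2, z)" for z x1 x2
    by (simp add: G_def)
  then show ?thesis
    unfolding mixed_norm_def by simp
qed

text \<open>Tonelli moves the expectation inside each integral, and the Jensen-type bound is applied
  with exponent \<open>p1 / p2\<close> in the inner variable and \<open>q / p1\<close> in the outer
  one, both at most 1. The constant involves \<open>T\<close> instead of \<open>S\<close>, hence is
  uniform over the shrinking domains.\<close>

lemma (in prob_space) mixed_norm_moment:
  fixes F :: "'a \<Rightarrow> real \<Rightarrow> real \<Rightarrow> 'b::{real_normed_vector, second_countable_topology}"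
  assumes meas: "(\<lambda>(x1, x2, \<omega>). F \<omega> x1 x2) \<in> borel_measurable (borel \<Otimes>\<^sub>M borel \<Otimes>\<^sub>M M)"
    and S: "0 \<le> S" "S \<le> T" "0 < T" and exps: "0 < q" "q \<le> p1" "p1 \<le> p2" and "0 < b"
    and bound: "\<And>x1 x2. x1 \<in> {0..S} \<Longrightarrow> x2 \<in> {-pi..pi} \<Longrightarrow>
      (\<integral>\<^sup>+\<omega>. ennreal (norm (F \<omega> x1 x2) powr p2) \<partial>M) \<le> ennreal b"
  shows "(\<integral>\<^sup>+\<omega>. epowr (mixed_norm S p1 p2 (F \<omega>)) q \<partial>M)
    \<le> ennreal (2 * (2 * T * (2 * pi) powr (p1 / p2)) powr (q / p1) * b powr (q / p2))"
proof -
  interpret PM: pair_sigma_finite "lborel :: real measure" M ..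
  define G where "G = (\<lambda>(x1, x2, \<omega>). F \<omega> x1 x2)"
  have [measurable]: "G \<in> borel_measurable (borel \<Otimes>\<^sub>M borel \<Otimes>\<^sub>M M)"
    unfolding G_def by fact
  have FG: "F \<omega> x1 x2 = G (x1, x2, \<omega>)" for \<omega> x1 x2
    by (simp add: G_def)
  define J where "J x1 \<omega> = (\<integral>\<^sup>+x2\<in>{-pi..pi}. ennreal (norm (F \<omega> x1 x2) powr p2) \<partial>lborel)" for x1 \<omega>
  define I where "I \<omega> = (\<integral>\<^sup>+x1\<in>{0..S}. epowr (J x1 \<omega>) (p1 / p2) \<partial>lborel)" for \<omega>
  have [measurable]: "(\<lambda>(x1, \<omega>). J x1 \<omega>) \<in> borel_measurable (borel \<Otimes>\<^sub>M M)"
    unfolding J_def FG by measurable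
  have [measurable]: "I \<in> borel_measurable M"
    unfolding I_def by measurable
  have EJ: "(\<integral>\<^sup>+\<omega>. J x1 \<omega> \<partial>M) \<le> ennreal (2 * pi * b)" if x1: "x1 \<in> {0..S}" for x1
  proof -
    have "(\<integral>\<^sup>+\<omega>. J x1 \<omega> \<partial>M) =
      (\<integral>\<^sup>+x2. (\<integral>\<^sup>+\<omega>. ennreal (norm (F \<omega> x1 x2) powr p2) * indicator {-pi..pi} x2 \<partial>M) \<partial>lborel)"
      unfolding J_def FG by (rule PM.Fubini') measurable
    also have "\<dots> = (\<integral>\<^sup>+x2\<in>{-pi..pi}. (\<integral>\<^sup>+\<omega>. ennreal (norm (F \<omega> x1 x2) powr p2) \<partial>M) \<partial>lborel)"
      unfolding FG by (intro nn_integral_cong nn_integral_multc) measurable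
    also have "\<dots> \<le> (\<integral>\<^sup>+x2\<in>{-pi..pi}. ennreal b \<partial>lborel)"
      using bound[OF x1] by (intro nn_integral_mono) (auto simp: indicator_def)
    also have "\<dots> = ennreal (2 * pi * b)"
      using \<open>0 < b\<close> by (simp add: nn_integral_cmult ennreal_mult[symmetric] mult_ac)
    finally show ?thesis .
  qed
  \<comment> \<open>The Jensen-type bound for fixed \<open>x1\<close>, times the length
    \<open>T\<close> in place of \<open>S\<close>. This keeps \<open>c\<close> positive even for
    \<open>S = 0\<close>, as the second application of that bound requires.\<close>
  define c where "c = 2 * (2 * pi * b) powr (p1 / p2) * T"
  have "0 < c"
    using \<open>0 < b\<close> \<open>0 < T\<close> by (simp add: c_def)
  have "(\<integral>\<^sup>+\<omega>. I \<omega> \<partial>M) =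
      (\<integral>\<^sup>+x1. (\<integral>\<^sup>+\<omega>. epowr (J x1 \<omega>) (p1 / p2) * indicator {0..S} x1 \<partial>M) \<partial>lborel)"
    unfolding I_def by (rule PM.Fubini') measurable
  also have "\<dots> = (\<integral>\<^sup>+x1\<in>{0..S}. (\<integral>\<^sup>+\<omega>. epowr (J x1 \<omega>) (p1 / p2) \<partial>M) \<partial>lborel)"
    by (intro nn_integral_cong nn_integral_multc) measurable
  also have "\<dots> \<le> (\<integral>\<^sup>+x1\<in>{0..S}. ennreal (2 * (2 * pi * b) powr (p1 / p2)) \<partial>lborel)"
    using exps \<open>0 < b\<close>
    by (intro nn_integral_mono) (auto simp: indicator_def intro!: nn_integral_epowr_le EJ)
  also have "\<dots> = ennreal (2 * (2 * pi * b) powr (p1 / p2) * S)"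
    using S by (simp add: nn_integral_cmult ennreal_mult)
  also have "\<dots> \<le> ennreal c"
    using S by (auto simp: c_def intro!: ennreal_leI mult_left_mono)
  finally have EI: "(\<integral>\<^sup>+\<omega>. I \<omega> \<partial>M) \<le> ennreal c" .
  have "(\<integral>\<^sup>+\<omega>. epowr (mixed_norm S p1 p2 (F \<omega>)) q \<partial>M) = (\<integral>\<^sup>+\<omega>. epowr (I \<omega>) (q / p1) \<partial>M)"
    using \<open>0 < q\<close> by (simp add: mixed_norm_def I_def J_def epowr_epowr)
  also have "\<dots> \<le> ennreal (2 * c powr (q / p1))"
    using exps \<open>0 < c\<close> EI by (intro nn_integral_epowr_le) auto
  \<comment> \<open>The exponents of \<open>b\<close> combine to (p1 / p2) * (q / p1) = q /
    p2.\<close>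
  also have "c powr (q / p1) = (2 * T * (2 * pi) powr (p1 / p2)) powr (q / p1) * b powr (q / p2)"
    using \<open>0 < b\<close> S exps by (simp add: c_def powr_mult powr_powr)
  finally show ?thesis
    by (simp add: mult_ac)
qed

text \<open>The weight cancels the moment bound exactly; at \<open>h = 0\<close> it is the junk value \<open>0\<close>.\<close>

lemma (in prob_space) weighted_nn_integral_le:
  fixes Z :: "real \<Rightarrow> 'a \<Rightarrow> ennreal"
  assumes [measurable]: "(\<lambda>(h, \<omega>). Z h \<omega>) \<in> borel_measurable (borel \<Otimes>\<^sub>M M)"
    and "0 \<le> K"
    and bound: "\<And>h. 0 < h \<Longrightarrow> h \<le> 1 \<Longrightarrow>
      (\<integral>\<^sup>+\<omega>. Z h \<omega> \<partial>M) \<le> ennreal (K * h powr (1 + \<alpha> * q))"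
  shows "(\<integral>\<^sup>+\<omega>. (\<integral>\<^sup>+h\<in>{0..1}. ennreal (h powr (- \<alpha> * q) / h) * Z h \<omega> \<partial>lborel) \<partial>M) \<le> ennreal K"
proof -
  interpret PM: pair_sigma_finite "lborel :: real measure" M ..
  have "(\<integral>\<^sup>+\<omega>. (\<integral>\<^sup>+h\<in>{0..1}. ennreal (h powr (- \<alpha> * q) / h) * Z h \<omega> \<partial>lborel) \<partial>M)
    = (\<integral>\<^sup>+h. (\<integral>\<^sup>+\<omega>. ennreal (h powr (- \<alpha> * q) / h) * Z h \<omega> * indicator {0..1} h \<partial>M) \<partial>lborel)"
    by (rule PM.Fubini') measurable
  also have "\<dots> = (\<integral>\<^sup>+h\<in>{0..1}. ennreal (h powr (- \<alpha> * q) / h) * (\<integral>\<^sup>+\<omega>. Z h \<omega> \<partial>M) \<partial>lborel)"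
    by (intro nn_integral_cong) (simp add: nn_integral_cmult nn_integral_multc)
  also have "\<dots> \<le> (\<integral>\<^sup>+h\<in>{0..1::real}. ennreal K \<partial>lborel)"
  proof (intro nn_integral_mono)
    fix h :: real
    show "ennreal (h powr (- \<alpha> * q) / h) * (\<integral>\<^sup>+\<omega>. Z h \<omega> \<partial>M) * indicator {0..1} h
      \<le> ennreal K * indicator {0..1} h"
    proof (cases "h \<in> {0<..1}")
      case True
      then have h: "0 < h" "h \<le> 1"
        by auto
      have "ennreal (h powr (- \<alpha> * q) / h) * (\<integral>\<^sup>+\<omega>. Z h \<omega> \<partial>M)
        \<le> ennreal (h powr (- \<alpha> * q) / h) * ennreal (K * h powr (1 + \<alpha> * q))"
        using bound[OF h] by (rule mult_left_mono) simp
      also have "\<dots> = ennreal (h powr (- \<alpha> * q) / h * (K * h powr (1 + \<alpha> * q)))"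
        using h \<open>0 \<le> K\<close> by (intro ennreal_mult[symmetric]) auto
      also have "h powr (- \<alpha> * q) / h * (K * h powr (1 + \<alpha> * q)) = K"
        using h by (simp add: powr_add powr_minus field_simps)
      finally show ?thesis
        using h by simp
    next
      case False
      then show ?thesis
        by (cases "h = 0") (auto simp: indicator_def)
    qed
  qed
  also have "\<dots> = ennreal K"
    by (simp add: nn_integral_cmult)
  finally show ?thesis .
qed

lemma measurable_mixed_norm_parametric:
  fixes F :: "real \<Rightarrow> 'a \<Rightarrow> real \<Rightarrow> real \<Rightarrow> 'b::{real_normed_vector, second_countable_topology}"
  assumes meas: "(\<lambda>(x1, x2, h, \<omega>). F h \<omega> x1 x2)
      \<in> borel_measurable (borel \<Otimes>\<^sub>M borel \<Otimes>\<^sub>M borel \<Otimes>\<^sub>M M)"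
    and [measurable]: "S \<in> borel_measurable borel"
  shows "(\<lambda>(h, \<omega>). mixed_norm (S h) p1 p2 (F h \<omega>)) \<in> borel_measurable (borel \<Otimes>\<^sub>M M)"
  unfolding case_prod_unfold
  by (rule measurable_mixed_norm) (use meas in \<open>simp_all add: case_prod_unfold\<close>)

text \<open>This serves three times: for the increments in \<open>x1\<close>, for those in
  \<open>x2\<close>, and for the inner integral over \<open>h2\<close> of rectangular increments at
  a fixed \<open>h1\<close>. In the last case \<open>B\<close> carries the dependence on
  \<open>h1\<close>, so it matters that the bound contains \<open>B\<close> exactly as
  \<open>B powr (q / p2)\<close>.\<close>

lemma (in prob_space) weighted_moment:
  fixes F :: "real \<Rightarrow> 'a \<Rightarrow> real \<Rightarrow> real \<Rightarrow> 'b::{real_normed_vector, second_countable_topology}"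
  assumes meas: "(\<lambda>(x1, x2, h, \<omega>). F h \<omega> x1 x2)
      \<in> borel_measurable (borel \<Otimes>\<^sub>M borel \<Otimes>\<^sub>M borel \<Otimes>\<^sub>M M)"
    and measS [measurable]: "S \<in> borel_measurable borel"
    and S: "\<And>h. h \<in> {0..1} \<Longrightarrow> 0 \<le> S h" "\<And>h. h \<in> {0..1} \<Longrightarrow> S h \<le> T"
    and "0 < T" and exps: "0 < q" "q \<le> p1" "p1 \<le> p2" and "0 < B"
    and bound: "\<And>h x1 x2. h \<in> {0..1} \<Longrightarrow> x1 \<in> {0..S h} \<Longrightarrow> x2 \<in> {-pi..pi} \<Longrightarrow>
      (\<integral>\<^sup>+\<omega>. ennreal (norm (F h \<omega> x1 x2) powr p2) \<partial>M)
        \<le> ennreal (B * h powr ((1 + \<alpha> * q) * (p2 / q)))"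
  shows "(\<integral>\<^sup>+\<omega>. (\<integral>\<^sup>+h\<in>{0..1}. ennreal (h powr (- \<alpha> * q) / h) *
             epowr (mixed_norm (S h) p1 p2 (F h \<omega>)) q \<partial>lborel) \<partial>M)
    \<le> ennreal (2 * (2 * T * (2 * pi) powr (p1 / p2)) powr (q / p1) * B powr (q / p2))"
proof (rule weighted_nn_integral_le)
  have [measurable]: "(\<lambda>(h, \<omega>). mixed_norm (S h) p1 p2 (F h \<omega>)) \<in> borel_measurable (borel \<Otimes>\<^sub>M M)"
    by (rule measurable_mixed_norm_parametric[OF meas measS])
  show "(\<lambda>(h, \<omega>). epowr (mixed_norm (S h) p1 p2 (F h \<omega>)) q) \<in> borel_measurable (borel \<Otimes>\<^sub>M M)"
    by measurable
  define K where "K = 2 * (2 * T * (2 * pi) powr (p1 / p2)) powr (q / p1)"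
  fix h :: real
  assume h: "0 < h" "h \<le> 1"
  define G where "G = (\<lambda>(x1, x2, h, \<omega>). F h \<omega> x1 x2)"
  have [measurable]: "G \<in> borel_measurable (borel \<Otimes>\<^sub>M borel \<Otimes>\<^sub>M borel \<Otimes>\<^sub>M M)"
    unfolding G_def by fact
  have "(\<lambda>(x1, x2, \<omega>). G (x1, x2, h, \<omega>)) \<in> borel_measurable (borel \<Otimes>\<^sub>M borel \<Otimes>\<^sub>M M)"
    by measurable
  then have F: "(\<lambda>(x1, x2, \<omega>). F h \<omega> x1 x2) \<in> borel_measurable (borel \<Otimes>\<^sub>M borel \<Otimes>\<^sub>M M)"
    by (simp add: G_def)
  define b where "b = B * h powr ((1 + \<alpha> * q) * (p2 / q))"
  have "0 < b"
    using \<open>0 < B\<close> h by (simp add: b_def)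
  have "(\<integral>\<^sup>+\<omega>. epowr (mixed_norm (S h) p1 p2 (F h \<omega>)) q \<partial>M) \<le> ennreal (K * b powr (q / p2))"
    unfolding K_def using F S h \<open>0 < T\<close> exps \<open>0 < b\<close> bound[of h]
    by (intro mixed_norm_moment) (auto simp: b_def)
  \<comment> \<open>Raising to \<open>q / p2\<close> turns the exponent (1 + \<alpha> q) p2 / q into
    1 + \<alpha> q, the one that the weight cancels.\<close>
  also have "b powr (q / p2) = B powr (q / p2) * h powr (1 + \<alpha> * q)"
    using \<open>0 < B\<close> h exps by (simp add: b_def powr_mult powr_powr)
  finally show "(\<integral>\<^sup>+\<omega>. epowr (mixed_norm (S h) p1 p2 (F h \<omega>)) q \<partial>M)
    \<le> ennreal (2 * (2 * T * (2 * pi) powr (p1 / p2)) powr (q / p1) * B powr (q / p2) * h powr (1 + \<alpha> * q))"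
    by (simp add: K_def mult_ac)
qed simp

section \<open>Pathwise properties of the norms, and joint measurability of fields\<close>

text \<open>The moment assumptions concern increments only, so the zeroth-order term of the Besov
  norm is handled pathwise through boundedness.\<close>

lemma mixed_norm_bounded:
  assumes "0 \<le> S" "0 < p1" "0 < p2"
    and B: "\<And>x1 x2. x1 \<in> {0..S} \<Longrightarrow> x2 \<in> {-pi..pi} \<Longrightarrow> norm (f x1 x2) \<le> B"
  shows "mixed_norm S p1 p2 f < \<infinity>"
proof -
  define c where "c = epowr (ennreal (B powr p2 * (2 * pi))) (p1 / p2)"
  have "c < \<infinity>"
    unfolding c_def by (intro epowr_less_top) simp
  have inner: "epowr (\<integral>\<^sup>+x2\<in>{-pi..pi}. ennreal (norm (f x1 x2) powr p2) \<partial>lborel) (p1 / p2) \<le> c"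
    if "x1 \<in> {0..S}" for x1
  proof -
    have "(\<integral>\<^sup>+x2\<in>{-pi..pi}. ennreal (norm (f x1 x2) powr p2) \<partial>lborel)
      \<le> (\<integral>\<^sup>+x2\<in>{-pi..pi}. ennreal (B powr p2) \<partial>lborel)"
      using B[OF that] \<open>0 < p2\<close>
      by (intro nn_integral_mono) (auto simp: indicator_def intro!: ennreal_leI powr_mono2)
    also have "\<dots> = ennreal (B powr p2 * (2 * pi))"
      by (simp add: nn_integral_cmult ennreal_mult)
    finally show ?thesis
      unfolding c_def using assms by (intro epowr_mono) auto
  qed
  have "(\<integral>\<^sup>+x1\<in>{0..S}. epowr (\<integral>\<^sup>+x2\<in>{-pi..pi}. ennreal (norm (f x1 x2) powr p2) \<partial>lborel) (p1 / p2) \<partial>lborel)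
    \<le> (\<integral>\<^sup>+x1\<in>{0..S}. c \<partial>lborel)"
    using inner by (intro nn_integral_mono) (auto simp: indicator_def)
  also have "\<dots> = c * ennreal S"
    using \<open>0 \<le> S\<close> by (simp add: nn_integral_cmult)
  also have "\<dots> < \<infinity>"
    using \<open>c < \<infinity>\<close> by (simp add: ennreal_mult_less_top)
  finally show ?thesis
    unfolding mixed_norm_def by (rule epowr_less_top)
qed

lemma mixed_norm_cong:
  assumes "\<And>x1 x2. x1 \<in> {0..S} \<Longrightarrow> f x1 x2 = g x1 x2"
  shows "mixed_norm S p1 p2 f = mixed_norm S p1 p2 g"
  unfolding mixed_norm_def
  by (intro arg_cong2[where f = epowr] nn_integral_cong refl) (auto simp: assms indicator_def)

text \<open>Steps \<open>h1\<close> up to 1 do not exceed \<open>T\<close>, so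
  \<open>x1 + h1\<close> stays in \<open>{0..T}\<close> for \<open>x1\<close> in the shrunken
  domain. The second variable is unrestricted because \<open>x2 + h2\<close> may leave
  \<open>{-pi..pi}\<close>.\<close>

lemma besov_norm_cong:
  assumes "1 \<le> T" and eq: "\<And>x1 x2. x1 \<in> {0..T} \<Longrightarrow> f x1 x2 = g x1 x2"
  shows "besov_norm T \<alpha>1 \<alpha>2 p1 p2 q1 q2 f = besov_norm T \<alpha>1 \<alpha>2 p1 p2 q1 q2 g"
proof -
  have rect: "mixed_norm (max (T - h1) 0) p1 p2 (rect_incr h1 h2 f) =
      mixed_norm (max (T - h1) 0) p1 p2 (rect_incr h1 h2 g)" if "h1 \<in> {0..1}" for h1 h2
    using that \<open>1 \<le> T\<close> by (intro mixed_norm_cong) (auto simp: rect_incr_def eq max_def split: if_splits)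
  have d1: "mixed_norm (max (T - h1) 0) p1 p2 (delta1 h1 f) =
      mixed_norm (max (T - h1) 0) p1 p2 (delta1 h1 g)" if "h1 \<in> {0..1}" for h1
    using that \<open>1 \<le> T\<close> by (intro mixed_norm_cong) (auto simp: delta1_def eq max_def split: if_splits)
  have d2: "mixed_norm T p1 p2 (delta2 h2 f) = mixed_norm T p1 p2 (delta2 h2 g)" for h2
    by (intro mixed_norm_cong) (auto simp: delta2_def eq)
  have d0: "mixed_norm T p1 p2 f = mixed_norm T p1 p2 g"
    by (intro mixed_norm_cong) (auto simp: eq)
  show ?thesis
    unfolding besov_norm_def d0 d2
    by (intro arg_cong2[where f = "(+)"] arg_cong2[where f = epowr] nn_integral_cong refl)
      (auto simp: rect d1 indicator_def)
qed

text \<open>A function that is measurable in one variable and continuous in the others is jointly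
  measurable, being the limit of its values at the grid points of mesh \<open>1 / n\<close>.\<close>

lemma measurable_Caratheodory:
  fixes X :: "real \<Rightarrow> real \<Rightarrow> 'a \<Rightarrow> 'b::metric_space"
  assumes X [measurable]: "\<And>x1 x2. X x1 x2 \<in> borel_measurable M"
    and cont: "\<And>\<omega>. \<omega> \<in> space M \<Longrightarrow> continuous_on UNIV (\<lambda>(x1, x2). X x1 x2 \<omega>)"
  shows "(\<lambda>(x1, x2, \<omega>). X x1 x2 \<omega>) \<in> borel_measurable (borel \<Otimes>\<^sub>M borel \<Otimes>\<^sub>M M)"
proof (rule borel_measurable_LIMSEQ_metric)
  define a where "a n i = real_of_int i / real (Suc n)" for n and i :: int
  define U where "U n = (\<lambda>(x1, x2, \<omega>).
    X (a n \<lfloor>real (Suc n) * x1\<rfloor>) (a n \<lfloor>real (Suc n) * x2\<rfloor>) \<omega>)" for n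
  show "U n \<in> borel_measurable (borel \<Otimes>\<^sub>M borel \<Otimes>\<^sub>M M)" for n
  proof -
    \<comment> \<open>The grid indices are integers, hence take countably many values. Freezing
      first one index and then the other leaves a single random variable
      \<open>X (a n i) (a n j)\<close>.\<close>
    have "(\<lambda>z. X (a n \<lfloor>real (Suc n) * fst z\<rfloor>) (a n \<lfloor>real (Suc n) * fst (snd z)\<rfloor>) (snd (snd z)))
      \<in> borel_measurable (borel \<Otimes>\<^sub>M borel \<Otimes>\<^sub>M M)"
    proof (rule measurable_compose_countable[where g = "\<lambda>z. \<lfloor>real (Suc n) * fst z\<rfloor>"])
      fix i
      show "(\<lambda>z. X (a n i) (a n \<lfloor>real (Suc n) * fst (snd z)\<rfloor>) (snd (snd z)))
        \<in> borel_measurable (borel \<Otimes>\<^sub>M borel \<Otimes>\<^sub>M M)"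
        by (rule measurable_compose_countable[where g = "\<lambda>z. \<lfloor>real (Suc n) * fst (snd z)\<rfloor>"]) measurable
    qed measurable
    then show ?thesis
      by (simp add: U_def case_prod_unfold)
  qed
  have a: "(\<lambda>n. a n \<lfloor>real (Suc n) * x\<rfloor>) \<longlonglongrightarrow> x" for x
  proof -
    \<comment> \<open>Rounding down moves the scaled point by less than 1, hence the point itself by
      less than the mesh size.\<close>
    have "norm (a n \<lfloor>real (Suc n) * x\<rfloor> - x) < 1 / real (Suc n)" for n
    proof -
      have "\<bar>real_of_int \<lfloor>real (Suc n) * x\<rfloor> - real (Suc n) * x\<bar> < 1"
        by linarith
      moreover have "a n \<lfloor>real (Suc n) * x\<rfloor> - x =
          (real_of_int \<lfloor>real (Suc n) * x\<rfloor> - real (Suc n) * x) / real (Suc n)"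
        by (simp add: a_def diff_divide_distrib del: of_nat_Suc)
      ultimately show ?thesis
        by (simp add: divide_strict_right_mono del: of_nat_Suc)
    qed
    then have "(\<lambda>n. a n \<lfloor>real (Suc n) * x\<rfloor> - x) \<longlonglongrightarrow> 0"
      by (rule LIMSEQ_norm_0)
    then show ?thesis
      by (rule LIM_zero_cancel)
  qed
  fix z :: "real \<times> real \<times> 'a"
  assume "z \<in> space (borel \<Otimes>\<^sub>M borel \<Otimes>\<^sub>M M)"
  then obtain x1 x2 \<omega> where z: "z = (x1, x2, \<omega>)" "\<omega> \<in> space M"
    by (auto simp: space_pair_measure)
  have "(\<lambda>n. (\<lambda>(x1, x2). X x1 x2 \<omega>) (a n \<lfloor>real (Suc n) * x1\<rfloor>, a n \<lfloor>real (Suc n) * x2\<rfloor>))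
      \<longlonglongrightarrow> (\<lambda>(x1, x2). X x1 x2 \<omega>) (x1, x2)"
    by (rule continuous_on_tendsto_compose[OF cont[OF z(2)] tendsto_Pair[OF a a]]) simp_all
  then show "(\<lambda>n. U n z) \<longlonglongrightarrow> (\<lambda>(x1, x2, \<omega>). X x1 x2 \<omega>) z"
    by (simp add: U_def z)
qed

section \<open>Almost sure finiteness for jointly measurable, everywhere continuous fields\<close>

text \<open>Each of the three seminorms, before its outermost root is taken, has finite expectation
  and is therefore finite almost surely. The remaining term is finite for every path by
  compactness.\<close>

lemma (in prob_space) besov_norm_AE_finite:
  fixes Y :: "real \<Rightarrow> real \<Rightarrow> 'a \<Rightarrow> 'b::{real_normed_vector, second_countable_topology}"
  assumes meas: "(\<lambda>(x1, x2, \<omega>). Y x1 x2 \<omega>) \<in> borel_measurable (borel \<Otimes>\<^sub>M borel \<Otimes>\<^sub>M M)"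
    and cont: "\<And>\<omega>. \<omega> \<in> space M \<Longrightarrow> continuous_on UNIV (\<lambda>(x1, x2). Y x1 x2 \<omega>)"
    and "1 \<le> T" and exps: "0 < q1" "q1 \<le> q2" "q2 \<le> p1" "p1 \<le> p2"
    and "0 < C"
    and rect: "\<And>h1 h2 x1 x2. h1 \<in> {0..1} \<Longrightarrow> h2 \<in> {0..1} \<Longrightarrow> x1 \<in> {0..T - h1} \<Longrightarrow> x2 \<in> {-pi..pi} \<Longrightarrow>
           (\<integral>\<^sup>+\<omega>. ennreal (norm (rect_incr h1 h2 (\<lambda>y1 y2. Y y1 y2 \<omega>) x1 x2) powr p2) \<partial>M)
             \<le> ennreal (C * h1 powr ((1 + \<alpha>1 * q1) * (p2 / q1)) * h2 powr ((1 + \<alpha>2 * q2) * (p2 / q2)))"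
    and d1: "\<And>h1 x1 x2. h1 \<in> {0..1} \<Longrightarrow> x1 \<in> {0..T - h1} \<Longrightarrow> x2 \<in> {-pi..pi} \<Longrightarrow>
           (\<integral>\<^sup>+\<omega>. ennreal (norm (delta1 h1 (\<lambda>y1 y2. Y y1 y2 \<omega>) x1 x2) powr p2) \<partial>M)
             \<le> ennreal (C * h1 powr ((1 + \<alpha>1 * q1) * (p2 / q1)))"
    and d2: "\<And>h2 x1 x2. h2 \<in> {0..1} \<Longrightarrow> x1 \<in> {0..T} \<Longrightarrow> x2 \<in> {-pi..pi} \<Longrightarrow>
           (\<integral>\<^sup>+\<omega>. ennreal (norm (delta2 h2 (\<lambda>y1 y2. Y y1 y2 \<omega>) x1 x2) powr p2) \<partial>M)
             \<le> ennreal (C * h2 powr ((1 + \<alpha>2 * q2) * (p2 / q2)))"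
  shows "AE \<omega> in M. besov_norm T \<alpha>1 \<alpha>2 p1 p2 q1 q2 (\<lambda>x1 x2. Y x1 x2 \<omega>) < \<infinity>"
proof -
  define G where "G = (\<lambda>(x1, x2, \<omega>). Y x1 x2 \<omega>)"
  have [measurable]: "G \<in> borel_measurable (borel \<Otimes>\<^sub>M borel \<Otimes>\<^sub>M M)"
    unfolding G_def by fact
  have YG: "Y x1 x2 \<omega> = G (x1, x2, \<omega>)" for \<omega> x1 x2
    by (simp add: G_def)
  have [measurable]: "(\<lambda>h. max (T - h) 0) \<in> borel_measurable borel"
    by measurable

  \<comment> \<open>\<open>meas0\<close> lets both steps vary and gives the joint measurability of
    the inner integral \<open>R\<close>; \<open>meas0'\<close> freezes \<open>h1\<close> and feeds
    the moment estimate over \<open>h2\<close>.\<close>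
  have meas0: "(\<lambda>(x1, x2, h2, h1, \<omega>). rect_incr h1 h2 (\<lambda>y1 y2. Y y1 y2 \<omega>) x1 x2)
      \<in> borel_measurable (borel \<Otimes>\<^sub>M borel \<Otimes>\<^sub>M borel \<Otimes>\<^sub>M borel \<Otimes>\<^sub>M M)"
    unfolding rect_incr_def YG by measurable
  have meas0': "(\<lambda>(x1, x2, h2, \<omega>). rect_incr h1 h2 (\<lambda>y1 y2. Y y1 y2 \<omega>) x1 x2)
      \<in> borel_measurable (borel \<Otimes>\<^sub>M borel \<Otimes>\<^sub>M borel \<Otimes>\<^sub>M M)" for h1
    unfolding rect_incr_def YG by measurable
  have meas1: "(\<lambda>(x1, x2, h, \<omega>). delta1 h (\<lambda>y1 y2. Y y1 y2 \<omega>) x1 x2)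
      \<in> borel_measurable (borel \<Otimes>\<^sub>M borel \<Otimes>\<^sub>M borel \<Otimes>\<^sub>M M)"
    unfolding delta1_def YG by measurable
  have meas2: "(\<lambda>(x1, x2, h, \<omega>). delta2 h (\<lambda>y1 y2. Y y1 y2 \<omega>) x1 x2)
      \<in> borel_measurable (borel \<Otimes>\<^sub>M borel \<Otimes>\<^sub>M borel \<Otimes>\<^sub>M M)"
    unfolding delta2_def YG by measurable

  \<comment> \<open>\<open>A1\<close> and \<open>A0\<close> are the powers with exponent
    \<open>q1\<close>, and \<open>A2\<close> that with exponent \<open>q2\<close>, of the seminorms
    of the first, the rectangular and the second increments.\<close>
  define A1 where "A1 \<omega> = (\<integral>\<^sup>+h1\<in>{0..1}. ennreal (h1 powr (- \<alpha>1 * q1) / h1) *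
    epowr (mixed_norm (max (T - h1) 0) p1 p2 (delta1 h1 (\<lambda>y1 y2. Y y1 y2 \<omega>))) q1 \<partial>lborel)" for \<omega>
  define A2 where "A2 \<omega> = (\<integral>\<^sup>+h2\<in>{0..1}. ennreal (h2 powr (- \<alpha>2 * q2) / h2) *
    epowr (mixed_norm T p1 p2 (delta2 h2 (\<lambda>y1 y2. Y y1 y2 \<omega>))) q2 \<partial>lborel)" for \<omega>
  define R where "R h1 \<omega> = (\<integral>\<^sup>+h2\<in>{0..1}. ennreal (h2 powr (- \<alpha>2 * q2) / h2) *
    epowr (mixed_norm (max (T - h1) 0) p1 p2 (rect_incr h1 h2 (\<lambda>y1 y2. Y y1 y2 \<omega>))) q2 \<partial>lborel)" for h1 \<omega>
  define A0 where "A0 \<omega> = (\<integral>\<^sup>+h1\<in>{0..1}. ennreal (h1 powr (- \<alpha>1 * q1) / h1) *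
    epowr (R h1 \<omega>) (q1 / q2) \<partial>lborel)" for \<omega>

  have [measurable]: "(\<lambda>(h, \<omega>). mixed_norm (max (T - h) 0) p1 p2 (delta1 h (\<lambda>y1 y2. Y y1 y2 \<omega>)))
      \<in> borel_measurable (borel \<Otimes>\<^sub>M M)"
    by (rule measurable_mixed_norm_parametric[OF meas1]) measurable
  have [measurable]: "(\<lambda>(h, \<omega>). mixed_norm T p1 p2 (delta2 h (\<lambda>y1 y2. Y y1 y2 \<omega>)))
      \<in> borel_measurable (borel \<Otimes>\<^sub>M M)"
    by (rule measurable_mixed_norm_parametric[OF meas2]) measurable
  define N where "N = (\<lambda>(h2, h1, \<omega>).
    mixed_norm (max (T - h1) 0) p1 p2 (rect_incr h1 h2 (\<lambda>y1 y2. Y y1 y2 \<omega>)))"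
  have [measurable]: "N \<in> borel_measurable (borel \<Otimes>\<^sub>M borel \<Otimes>\<^sub>M M)"
    unfolding N_def case_prod_unfold
    by (rule measurable_mixed_norm) (use meas0 in \<open>simp_all add: case_prod_unfold\<close>)
  have RN: "R h1 \<omega> = (\<integral>\<^sup>+h2\<in>{0..1}. ennreal (h2 powr (- \<alpha>2 * q2) / h2) *
    epowr (N (h2, h1, \<omega>)) q2 \<partial>lborel)" for h1 \<omega>
    by (simp add: R_def N_def)
  have [measurable]: "(\<lambda>(h1, \<omega>). R h1 \<omega>) \<in> borel_measurable (borel \<Otimes>\<^sub>M M)"
    unfolding RN by measurable
  have [measurable]: "A0 \<in> borel_measurable M" "A1 \<in> borel_measurable M" "A2 \<in> borel_measurable M"
    unfolding A0_def A1_def A2_def by measurable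

  \<comment> \<open>The constant of \<open>weighted_moment\<close> for the exponent
    \<open>q2\<close>, shared by \<open>A2\<close> and by \<open>R h1\<close>.\<close>
  define K where "K = 2 * (2 * T * (2 * pi) powr (p1 / p2)) powr (q2 / p1)"
  have "0 < K"
    using \<open>1 \<le> T\<close> by (simp add: K_def)

  have "(\<integral>\<^sup>+\<omega>. A1 \<omega> \<partial>M) \<le>
      ennreal (2 * (2 * T * (2 * pi) powr (p1 / p2)) powr (q1 / p1) * C powr (q1 / p2))"
    unfolding A1_def
    by (rule weighted_moment[OF meas1]) (use \<open>1 \<le> T\<close> \<open>0 < C\<close> exps d1 in \<open>auto simp: max_def split: if_splits\<close>)
  then have fin1: "(\<integral>\<^sup>+\<omega>. A1 \<omega> \<partial>M) \<noteq> \<infinity>"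
    by (auto simp: top_unique)
  have "(\<integral>\<^sup>+\<omega>. A2 \<omega> \<partial>M) \<le> ennreal (K * C powr (q2 / p2))"
    unfolding A2_def K_def
    by (rule weighted_moment[OF meas2]) (use \<open>1 \<le> T\<close> \<open>0 < C\<close> exps d2 in auto)
  then have fin2: "(\<integral>\<^sup>+\<omega>. A2 \<omega> \<partial>M) \<noteq> \<infinity>"
    by (auto simp: top_unique)
  have "(\<integral>\<^sup>+\<omega>. A0 \<omega> \<partial>M) \<le> ennreal (2 * (K * C powr (q2 / p2)) powr (q1 / q2))"
    unfolding A0_def
  proof (rule weighted_nn_integral_le)
    show "(\<lambda>(h1, \<omega>). epowr (R h1 \<omega>) (q1 / q2)) \<in> borel_measurable (borel \<Otimes>\<^sub>M M)"
      by measurable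
    fix h1 :: real
    assume h1: "0 < h1" "h1 \<le> 1"
    \<comment> \<open>For fixed \<open>h1\<close> the whole factor in \<open>h1\<close> of the
      rectangular moment bound counts as a constant.\<close>
    define B where "B = C * h1 powr ((1 + \<alpha>1 * q1) * (p2 / q1))"
    have "0 < B"
      using \<open>0 < C\<close> h1 by (simp add: B_def)
    have "(\<integral>\<^sup>+\<omega>. R h1 \<omega> \<partial>M) \<le> ennreal (K * B powr (q2 / p2))"
      unfolding R_def K_def
      by (rule weighted_moment[OF meas0'])
        (use \<open>1 \<le> T\<close> \<open>0 < B\<close> h1 exps rect in \<open>auto simp: max_def B_def split: if_splits\<close>)
    then have "(\<integral>\<^sup>+\<omega>. epowr (R h1 \<omega>) (q1 / q2) \<partial>M) \<le> ennreal (2 * (K * B powr (q2 / p2)) powr (q1 / q2))"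
      using exps \<open>0 < K\<close> \<open>0 < B\<close> by (intro nn_integral_epowr_le) auto
    \<comment> \<open>The exponent of \<open>h1\<close> becomes (1 + \<alpha>1 q1) (p2 / q1) (q2 /
      p2) (q1 / q2) = 1 + \<alpha>1 q1, so the outer weight cancels as well.\<close>
    also have "(K * B powr (q2 / p2)) powr (q1 / q2) =
        (K * C powr (q2 / p2)) powr (q1 / q2) * h1 powr (1 + \<alpha>1 * q1)"
      using exps \<open>0 < K\<close> \<open>0 < C\<close> h1 by (simp add: B_def powr_mult powr_powr)
    finally show "(\<integral>\<^sup>+\<omega>. epowr (R h1 \<omega>) (q1 / q2) \<partial>M)
        \<le> ennreal (2 * (K * C powr (q2 / p2)) powr (q1 / q2) * h1 powr (1 + \<alpha>1 * q1))"
      by (simp add: mult_ac)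
  qed simp
  then have fin0: "(\<integral>\<^sup>+\<omega>. A0 \<omega> \<partial>M) \<noteq> \<infinity>"
    by (auto simp: top_unique)

  have Y: "mixed_norm T p1 p2 (\<lambda>x1 x2. Y x1 x2 \<omega>) < \<infinity>" if "\<omega> \<in> space M" for \<omega>
  proof -
    have "compact ((\<lambda>(x1, x2). Y x1 x2 \<omega>) ` ({0..T} \<times> {-pi..pi}))"
      using cont[OF that] by (intro compact_continuous_image compact_Times)
        (auto intro: continuous_on_subset)
    then obtain B where "\<And>y. y \<in> (\<lambda>(x1, x2). Y x1 x2 \<omega>) ` ({0..T} \<times> {-pi..pi}) \<Longrightarrow> norm y \<le> B"
      using compact_imp_bounded bounded_iff by metis
    then show ?thesis
      using \<open>1 \<le> T\<close> exps by (intro mixed_norm_bounded[where B = B]) force+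
  qed
  have "AE \<omega> in M. A0 \<omega> \<noteq> \<infinity>" "AE \<omega> in M. A1 \<omega> \<noteq> \<infinity>" "AE \<omega> in M. A2 \<omega> \<noteq> \<infinity>"
    by (rule nn_integral_PInf_AE[OF _ fin0] nn_integral_PInf_AE[OF _ fin1] nn_integral_PInf_AE[OF _ fin2], measurable)+
  with AE_space show ?thesis
  proof eventually_elim
    case (elim \<omega>)
    then have "epowr (A0 \<omega>) (1 / q1) < \<infinity>" "epowr (A1 \<omega>) (1 / q1) < \<infinity>" "epowr (A2 \<omega>) (1 / q2) < \<infinity>"
      by (simp_all add: epowr_def less_top)
    then show ?case
      using Y[OF elim(1)] unfolding besov_norm_def A0_def A1_def A2_def R_def by simp
  qed
qed

section \<open>Reduction of a general continuous random field to a regular modification\<close>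

theorem proposition4p1:
  fixes M :: "'a measure"
    and X :: "real \<Rightarrow> real \<Rightarrow> 'a \<Rightarrow> real ^ 'm"
    and T C \<alpha>1 \<alpha>2 p1 p2 q1 q2 :: real
  assumes "prob_space M"
    and "1 \<le> T"
    and "continuous_random_field M T X"
    and "1 \<le> q1" "q1 \<le> q2" "q2 \<le> p1" "p1 \<le> p2"
    and "0 < \<alpha>1" "\<alpha>1 < 1" "0 < \<alpha>2" "\<alpha>2 < 1"
    and "0 < C"
    and "\<And>h1 h2 x1 x2. h1 \<in> {0..T} \<Longrightarrow> h2 \<in> {0..T} \<Longrightarrow> x1 \<in> {0..T - h1} \<Longrightarrow> x2 \<in> {-pi..pi} \<Longrightarrow>
           (\<integral>\<^sup>+\<omega>. ennreal (norm (rect_incr h1 h2 (\<lambda>y1 y2. X y1 y2 \<omega>) x1 x2) powr p2) \<partial>M)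
             \<le> ennreal (C * h1 powr ((1 + \<alpha>1 * q1) * (p2 / q1)) * h2 powr ((1 + \<alpha>2 * q2) * (p2 / q2)))"
    and "\<And>h1 x1 x2. h1 \<in> {0..T} \<Longrightarrow> x1 \<in> {0..T - h1} \<Longrightarrow> x2 \<in> {-pi..pi} \<Longrightarrow>
           (\<integral>\<^sup>+\<omega>. ennreal (norm (delta1 h1 (\<lambda>y1 y2. X y1 y2 \<omega>) x1 x2) powr p2) \<partial>M)
             \<le> ennreal (C * h1 powr ((1 + \<alpha>1 * q1) * (p2 / q1)))"
    and "\<And>h2 x1 x2. h2 \<in> {0..T} \<Longrightarrow> x1 \<in> {0..T} \<Longrightarrow> x2 \<in> {-pi..pi} \<Longrightarrow>
           (\<integral>\<^sup>+\<omega>. ennreal (norm (delta2 h2 (\<lambda>y1 y2. X y1 y2 \<omega>) x1 x2) powr p2) \<partial>M)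
             \<le> ennreal (C * h2 powr ((1 + \<alpha>2 * q2) * (p2 / q2)))"
  shows "AE \<omega> in M. besov_norm T \<alpha>1 \<alpha>2 p1 p2 q1 q2 (\<lambda>x1 x2. X x1 x2 \<omega>) < \<infinity>"
proof -
  interpret prob_space M by fact
  have X: "X x1 x2 \<in> borel_measurable M" if "x1 \<in> {0..T}" for x1 x2
    using assms(3) that by (auto simp: continuous_random_field_def)
  have "AE \<omega> in M. continuous_on ({0..T} \<times> UNIV) (\<lambda>(x1, x2). X x1 x2 \<omega>)"
    using assms(3) by (simp add: continuous_random_field_def)
  then obtain N where N: "N \<in> null_sets M" and
    cont: "\<And>\<omega>. \<omega> \<in> space M - N \<Longrightarrow> continuous_on ({0..T} \<times> UNIV) (\<lambda>(x1, x2). X x1 x2 \<omega>)"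
    by (auto elim!: AE_E3)
  have [measurable]: "N \<in> sets M"
    using N by auto
  \<comment> \<open>The retraction of the line onto \<open>{0..T}\<close>: measurability and
    continuity of \<open>X\<close> are given only for \<open>x1\<close> in this interval.\<close>
  define clip where "clip x1 = max 0 (min T x1)" for x1
  have clip: "clip x1 \<in> {0..T}" for x1
    using \<open>1 \<le> T\<close> by (auto simp: clip_def)
  have clip_id: "clip x1 = x1" if "x1 \<in> {0..T}" for x1
    using that by (auto simp: clip_def)
  define Y where "Y x1 x2 \<omega> = (if \<omega> \<in> N then 0 else X (clip x1) x2 \<omega>)" for x1 x2 \<omega>
  have contY: "continuous_on UNIV (\<lambda>(x1, x2). Y x1 x2 \<omega>)" if "\<omega> \<in> space M" for \<omega>
  proof (cases "\<omega> \<in> N")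
    case False
    have "continuous_on UNIV (\<lambda>z :: real \<times> real. (\<lambda>(x1, x2). X x1 x2 \<omega>) (clip (fst z), snd z))"
    proof (rule continuous_on_compose2[OF cont])
      show "continuous_on UNIV (\<lambda>z :: real \<times> real. (clip (fst z), snd z))"
        unfolding clip_def by (intro continuous_intros)
    qed (use that False clip in auto)
    then show ?thesis
      using False by (simp add: Y_def case_prod_unfold)
  qed (simp add: Y_def case_prod_unfold)
  have measY: "(\<lambda>(x1, x2, \<omega>). Y x1 x2 \<omega>) \<in> borel_measurable (borel \<Otimes>\<^sub>M borel \<Otimes>\<^sub>M M)"
  proof (rule measurable_Caratheodory[OF _ contY])
    show "Y x1 x2 \<in> borel_measurable M" for x1 x2
    proof -
      have [measurable]: "X (clip x1) x2 \<in> borel_measurable M"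
        using clip by (rule X)
      show ?thesis
        unfolding Y_def by measurable
    qed
  qed
  have YX: "Y x1 x2 \<omega> = (if \<omega> \<in> N then 0 else X x1 x2 \<omega>)" if "x1 \<in> {0..T}" for x1 x2 \<omega>
    using that by (simp add: Y_def clip_id)
  have "AE \<omega> in M. besov_norm T \<alpha>1 \<alpha>2 p1 p2 q1 q2 (\<lambda>x1 x2. Y x1 x2 \<omega>) < \<infinity>"
  proof (rule besov_norm_AE_finite[OF measY contY])
    fix h1 h2 x1 x2 :: real
    assume h: "h1 \<in> {0..1}" "h2 \<in> {0..1}" and x: "x1 \<in> {0..T - h1}" "x2 \<in> {-pi..pi}"
    \<comment> \<open>On \<open>N\<close> the increment of \<open>Y\<close> vanishes and
      \<open>0 powr p2 = 0\<close>; off \<open>N\<close> it equals that of \<open>X\<close>, because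
      \<open>x1\<close> and \<open>x1 + h1\<close> lie in \<open>{0..T}\<close>. So the integrands
      compare pointwise.\<close>
    have "(\<integral>\<^sup>+\<omega>. ennreal (norm (rect_incr h1 h2 (\<lambda>y1 y2. Y y1 y2 \<omega>) x1 x2) powr p2) \<partial>M) \<le>
      (\<integral>\<^sup>+\<omega>. ennreal (norm (rect_incr h1 h2 (\<lambda>y1 y2. X y1 y2 \<omega>) x1 x2) powr p2) \<partial>M)"
      using h x by (intro nn_integral_mono) (auto simp: rect_incr_def YX)
    \<comment> \<open>The moment bounds apply because 1 \<le> \<open>T\<close> places the steps in
      \<open>{0..1}\<close> inside \<open>{0..T}\<close>.\<close>
    also have "\<dots> \<le> ennreal (C * h1 powr ((1 + \<alpha>1 * q1) * (p2 / q1)) * h2 powr ((1 + \<alpha>2 * q2) * (p2 / q2)))"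
      using h x \<open>1 \<le> T\<close> by (intro assms(13)) auto
    finally show "(\<integral>\<^sup>+\<omega>. ennreal (norm (rect_incr h1 h2 (\<lambda>y1 y2. Y y1 y2 \<omega>) x1 x2) powr p2) \<partial>M) \<le> \<dots>" .
  next
    fix h1 x1 x2 :: real
    assume h: "h1 \<in> {0..1}" and x: "x1 \<in> {0..T - h1}" "x2 \<in> {-pi..pi}"
    have "(\<integral>\<^sup>+\<omega>. ennreal (norm (delta1 h1 (\<lambda>y1 y2. Y y1 y2 \<omega>) x1 x2) powr p2) \<partial>M) \<le>
      (\<integral>\<^sup>+\<omega>. ennreal (norm (delta1 h1 (\<lambda>y1 y2. X y1 y2 \<omega>) x1 x2) powr p2) \<partial>M)"
      using h x by (intro nn_integral_mono) (auto simp: delta1_def YX)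
    also have "\<dots> \<le> ennreal (C * h1 powr ((1 + \<alpha>1 * q1) * (p2 / q1)))"
      using h x \<open>1 \<le> T\<close> by (intro assms(14)) auto
    finally show "(\<integral>\<^sup>+\<omega>. ennreal (norm (delta1 h1 (\<lambda>y1 y2. Y y1 y2 \<omega>) x1 x2) powr p2) \<partial>M) \<le> \<dots>" .
  next
    fix h2 x1 x2 :: real
    assume h: "h2 \<in> {0..1}" and x: "x1 \<in> {0..T}" "x2 \<in> {-pi..pi}"
    have "(\<integral>\<^sup>+\<omega>. ennreal (norm (delta2 h2 (\<lambda>y1 y2. Y y1 y2 \<omega>) x1 x2) powr p2) \<partial>M) \<le>
      (\<integral>\<^sup>+\<omega>. ennreal (norm (delta2 h2 (\<lambda>y1 y2. X y1 y2 \<omega>) x1 x2) powr p2) \<partial>M)"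
      using x by (intro nn_integral_mono) (auto simp: delta2_def YX)
    also have "\<dots> \<le> ennreal (C * h2 powr ((1 + \<alpha>2 * q2) * (p2 / q2)))"
      using h x \<open>1 \<le> T\<close> by (intro assms(15)) auto
    finally show "(\<integral>\<^sup>+\<omega>. ennreal (norm (delta2 h2 (\<lambda>y1 y2. Y y1 y2 \<omega>) x1 x2) powr p2) \<partial>M) \<le> \<dots>" .
  qed (use assms in auto)
  moreover have "AE \<omega> in M. \<omega> \<notin> N"
    using N by (rule AE_not_in)
  ultimately show ?thesis
  proof eventually_elim
    case (elim \<omega>)
    \<comment> \<open>Off \<open>N\<close> the two paths agree for all \<open>x1\<close> in
      \<open>{0..T}\<close>, which determines the norm.\<close>
    have "besov_norm T \<alpha>1 \<alpha>2 p1 p2 q1 q2 (\<lambda>x1 x2. X x1 x2 \<omega>) =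
        besov_norm T \<alpha>1 \<alpha>2 p1 p2 q1 q2 (\<lambda>x1 x2. Y x1 x2 \<omega>)"
      using \<open>1 \<le> T\<close> elim(2) by (intro besov_norm_cong) (auto simp: YX)
    with elim(1) show ?case
      by simp
  qed
qed

end
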